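(* Let $\boldsymbol{\alpha}$ be a set of $\mathcal{T}$-atoms and consider a form of $\mathcal{T}$-DDs which is $\mathcal{B}$-canonical with respect to some canonicity condition $K(\boldsymbol{\alpha})$. Suppose that for every $\mathcal{T}$-formula $\varphi[\boldsymbol{\alpha}]$, $$\mathcal{T}\text{-DD}(\varphi[\boldsymbol{\alpha}])\ \equiv_{\mathcal{B}}\ \bigvee_{\eta_i\in\mathrm{TTA}^{\mathcal{T}}_{\boldsymbol{\alpha}}(\varphi)}\eta_i .$$ Then this form of $\mathcal{T}$-DDs is $\mathcal{T}$-canonical with respect to $K(\boldsymbol{\alpha})$.
   Context: All formulas are quantifier-free $\mathcal{T}$-formulas (Boolean combinations of ground $\mathcal{T}$-atoms, $\mathcal{T}$ a first-order theory). $\mathcal{T}2\mathcal{B}$ is the Boolean abstraction (bijection mapping Boolean atoms to themselves and other $\mathcal{T}$-atoms to fresh Boolean variables, homomorphic over connectives), $\mathcal{B}2\mathcal{T}$ its inverse, $\psi^p:=\mathcal{T}2\mathcal{B}(\psi)$. $\varphi[\boldsymbol{\alpha}]$ means $\varphi$ regarded over a set $\boldsymbol{\alpha}$ containing all its atoms. $\psi\equiv_{\mathcal{B}}\psi'$: $\psi^p,\psi'^p$ propositionally equivalent; $\psi\equiv_{\mathcal{T}}\psi'$: equivalent modulo $\mathcal{T}$. Truth assignments are conjunctions of literals; total on $\boldsymbol{\alpha}$ means one literal per atom of $\boldsymbol{\alpha}$; $\eta\models_p\varphi$ means $\eta^p\models\varphi^p$. $\mathrm{TTA}^{\mathcal{T}}_{\boldsymbol{\alpha}}(\varphi)$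 is the set of $\mathcal{T}$-consistent (satisfiable in some model of $\mathcal{T}$) total truth assignments $\eta$ on $\boldsymbol{\alpha}$ with $\eta\models_p\varphi$. A form of Boolean decision diagrams (e.g. OBDDs, SDDs) has a canonicity condition $K(\mathbf{A})$ on Boolean atoms $\mathbf{A}$ (e.g. variable order, v-tree). Given $\mathbf{A}=\mathcal{T}2\mathcal{B}(\boldsymbol{\alpha})$, a $\mathcal{T}$-DD of $\varphi[\boldsymbol{\alpha}]$ with canonicity condition $K(\boldsymbol{\alpha})$ is a $\mathcal{T}$-formula $\Psi[\boldsymbol{\alpha}]$ with $\Psi\equiv_{\mathcal{T}}\varphi$ whose Boolean abstraction $\Psi^p[\mathbf{A}]$ is a decision diagram of that form; equality of $\mathcal{T}$-DDs is identity of diagrams. A form of $\mathcal{T}$-DD is $\mathcal{B}$-canonical w.r.t. $K(\boldsymbol{\alpha})$ if for all $\varphi[\boldsymbol{\alpha}],\varphi'[\boldsymbol{\alpha}]$: $\mathcal{T}\text{-DD}(\varphi)=\mathcal{T}\text{-DD}(\varphi')$ whenever $\varphi\equiv_{\mathcal{B}}\varphi'$. It is $\mathcal{T}$-canonical w.r.t. $K(\boldsymbol{\alpha})$ if for all $\varphi[\boldsymbol{\alpha}],\varphi'[\boldsymbol{\alpha}]$: $\mathcal{T}\text{-DD}(\varphi)=\mathcal{T}\text{-DD}(\varphi')$ if and only if $\varphi\equiv_{\mathcal{T}}\varphi'$.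
   Formalization: K(α) is additionally required to make propositionally equivalent diagrams satisfying it identical (B-canonicity as worded does not suffice); α is finite, and models of T have domains inside one arbitrary fixed type (enough by Löwenheim–Skolem). *)

theory Defs
  imports Main
begin

section \<open>First-order theories and their models\<close>

text \<open>Symbols carry no declared arity: a symbol used with two different numbers of arguments
  acts as two different symbols. Free constants, as used in SMT, are nullary function symbols that
  the axioms do not mention.\<close>

datatype 'f trm = Var nat | Fun 'f "'f trm list"

datatype ('f, 'p, 'b) atom =
    is_BoolAt: BoolAt 'b
  | PredAt 'p "'f trm list"
  | EqAt "'f trm" "'f trm"

datatype ('f, 'p, 'b) fo_formula =
    FAtom "('f, 'p, 'b) atom"
  | FNot "('f, 'p, 'b) fo_formula"
  | FAnd "('f, 'p, 'b) fo_formula" "('f, 'p, 'b) fo_formula"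
  | FAll nat "('f, 'p, 'b) fo_formula"

primrec trm_vars :: "'f trm \<Rightarrow> nat set" where
  "trm_vars (Var x) = {x}"
| "trm_vars (Fun f ts) = \<Union> (set (map trm_vars ts))"

primrec atom_vars :: "('f, 'p, 'b) atom \<Rightarrow> nat set" where
  "atom_vars (BoolAt b) = {}"
| "atom_vars (PredAt p ts) = (\<Union>t\<in>set ts. trm_vars t)"
| "atom_vars (EqAt s t) = trm_vars s \<union> trm_vars t"

primrec free_vars :: "('f, 'p, 'b) fo_formula \<Rightarrow> nat set" where
  "free_vars (FAtom a) = atom_vars a"
| "free_vars (FNot \<phi>) = free_vars \<phi>"
| "free_vars (FAnd \<phi> \<psi>) = free_vars \<phi> \<union> free_vars \<psi>"
| "free_vars (FAll x \<phi>) = free_vars \<phi> - {x}"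

definition fo_theory :: "('f, 'p, 'b) fo_formula set \<Rightarrow> bool" where
  "fo_theory T \<longleftrightarrow> (\<forall>\<phi>\<in>T. free_vars \<phi> = {})"

record ('f, 'p, 'b, 'u) struct =
  dom :: "'u set"
  fn :: "'f \<Rightarrow> 'u list \<Rightarrow> 'u"
  rel :: "'p \<Rightarrow> 'u list \<Rightarrow> bool"
  bval :: "'b \<Rightarrow> bool"

definition wf_struct :: "('f, 'p, 'b, 'u) struct \<Rightarrow> bool" where
  "wf_struct M \<longleftrightarrow> dom M \<noteq> {} \<and> (\<forall>f us. set us \<subseteq> dom M \<longrightarrow> fn M f us \<in> dom M)"

primrec trm_val :: "('f, 'p, 'b, 'u) struct \<Rightarrow> (nat \<Rightarrow> 'u) \<Rightarrow> 'f trm \<Rightarrow> 'u" where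
  "trm_val M e (Var x) = e x"
| "trm_val M e (Fun f ts) = fn M f (map (trm_val M e) ts)"

primrec atom_sat :: "('f, 'p, 'b, 'u) struct \<Rightarrow> (nat \<Rightarrow> 'u) \<Rightarrow> ('f, 'p, 'b) atom \<Rightarrow> bool" where
  "atom_sat M e (BoolAt b) \<longleftrightarrow> bval M b"
| "atom_sat M e (PredAt p ts) \<longleftrightarrow> rel M p (map (trm_val M e) ts)"
| "atom_sat M e (EqAt s t) \<longleftrightarrow> trm_val M e s = trm_val M e t"

primrec fo_sat :: "('f, 'p, 'b, 'u) struct \<Rightarrow> (nat \<Rightarrow> 'u) \<Rightarrow> ('f, 'p, 'b) fo_formula \<Rightarrow> bool" where
  "fo_sat M e (FAtom a) \<longleftrightarrow> atom_sat M e a"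
| "fo_sat M e (FNot \<phi>) \<longleftrightarrow> \<not> fo_sat M e \<phi>"
| "fo_sat M e (FAnd \<phi> \<psi>) \<longleftrightarrow> fo_sat M e \<phi> \<and> fo_sat M e \<psi>"
| "fo_sat M e (FAll x \<phi>) \<longleftrightarrow> (\<forall>u\<in>dom M. fo_sat M (e(x := u)) \<phi>)"

text \<open>HOL cannot quantify over types inside a formula, so the type that the domains of models are
  subsets of is passed as an argument. By the downward Loewenheim-Skolem theorem an infinite type at
  least as large as the set of formulas yields the usual notions of satisfiability and equivalence
  modulo a theory.\<close>

definition models :: "'u itself \<Rightarrow> ('f, 'p, 'b) fo_formula set \<Rightarrow> ('f, 'p, 'b, 'u) struct set" where
  "models U T = {M. wf_struct M \<and> (\<forall>\<phi>\<in>T. \<forall>e. range e \<subseteq> dom M \<longrightarrow> fo_sat M e \<phi>)}"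


section \<open>Quantifier-free formulas\<close>

text \<open>Boolean combinations over an arbitrary type of atoms; used both with theory atoms and with
  Boolean variables, so that the Boolean abstraction of a formula is its image under
  \<^term>\<open>map_form\<close>.\<close>

datatype (atoms: 'a) form =
    Top
  | Bot
  | Atom 'a
  | Not "'a form"
  | And "'a form" "'a form"
  | Or "'a form" "'a form"
  | Imp "'a form" "'a form"
  | Iff "'a form" "'a form"

primrec eval :: "('a \<Rightarrow> bool) \<Rightarrow> 'a form \<Rightarrow> bool" where
  "eval v Top \<longleftrightarrow> True"
| "eval v Bot \<longleftrightarrow> False"
| "eval v (Atom a) \<longleftrightarrow> v a"
| "eval v (Not \<phi>) \<longleftrightarrow> \<not> eval v \<phi>"
| "eval v (And \<phi> \<psi>) \<longleftrightarrow> eval v \<phi> \<and> eval v \<psi>"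
| "eval v (Or \<phi> \<psi>) \<longleftrightarrow> eval v \<phi> \<or> eval v \<psi>"
| "eval v (Imp \<phi> \<psi>) \<longleftrightarrow> (eval v \<phi> \<longrightarrow> eval v \<psi>)"
| "eval v (Iff \<phi> \<psi>) \<longleftrightarrow> (eval v \<phi> \<longleftrightarrow> eval v \<psi>)"

definition prop_entails :: "'a form \<Rightarrow> 'a form \<Rightarrow> bool" where
  "prop_entails \<phi> \<psi> \<longleftrightarrow> (\<forall>v. eval v \<phi> \<longrightarrow> eval v \<psi>)"

definition prop_equiv :: "'a form \<Rightarrow> 'a form \<Rightarrow> bool" where
  "prop_equiv \<phi> \<psi> \<longleftrightarrow> (\<forall>v. eval v \<phi> \<longleftrightarrow> eval v \<psi>)"

definition enum_of :: "'a set \<Rightarrow> 'a list" where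
  "enum_of S = (SOME xs. distinct xs \<and> set xs = S)"

text \<open>Conjunction and disjunction of a finite set of formulas, in an arbitrary order.\<close>

definition BigAnd :: "'a form set \<Rightarrow> 'a form" where
  "BigAnd S = foldr And (enum_of S) Top"

definition BigOr :: "'a form set \<Rightarrow> 'a form" where
  "BigOr S = foldr Or (enum_of S) Bot"

text \<open>The atoms of the language whose Boolean atoms are \<open>B\<close>.\<close>

definition T_atoms :: "'b set \<Rightarrow> ('f, 'p, 'b) atom set" where
  "T_atoms B = BoolAt ` B \<union> {a. \<not> is_BoolAt a \<and> atom_vars a = {}}"

definition formulas_over :: "'a set \<Rightarrow> 'a form set" where
  "formulas_over \<alpha> = {\<phi>. atoms \<phi> \<subseteq> \<alpha>}"

text \<open>The atoms concerned are ground, so the choice of the variable assignment is immaterial.\<close>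

definition T_sat :: "('f, 'p, 'b, 'u) struct \<Rightarrow> ('f, 'p, 'b) atom form \<Rightarrow> bool" where
  "T_sat M \<phi> \<longleftrightarrow> eval (atom_sat M (\<lambda>_. SOME u. u \<in> dom M)) \<phi>"

definition T_consistent ::
  "'u itself \<Rightarrow> ('f, 'p, 'b) fo_formula set \<Rightarrow> ('f, 'p, 'b) atom form \<Rightarrow> bool" where
  "T_consistent U T \<phi> \<longleftrightarrow> (\<exists>M\<in>models U T. T_sat M \<phi>)"

definition T_equiv ::
  "'u itself \<Rightarrow> ('f, 'p, 'b) fo_formula set \<Rightarrow> ('f, 'p, 'b) atom form \<Rightarrow> ('f, 'p, 'b) atom form \<Rightarrow> bool"
where
  "T_equiv U T \<phi> \<psi> \<longleftrightarrow> (\<forall>M\<in>models U T. T_sat M \<phi> \<longleftrightarrow> T_sat M \<psi>)"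


section \<open>Boolean abstraction and truth assignments\<close>

definition boolean_abstraction :: "'b set \<Rightarrow> (('f, 'p, 'b) atom \<Rightarrow> 'b) \<Rightarrow> bool" where
  "boolean_abstraction B t2b \<longleftrightarrow>
     inj_on t2b (T_atoms B) \<and>
     (\<forall>b\<in>B. t2b (BoolAt b) = b) \<and>
     (\<forall>a\<in>T_atoms B. \<not> is_BoolAt a \<longrightarrow> t2b a \<notin> B)"

definition T2B :: "(('f, 'p, 'b) atom \<Rightarrow> 'b) \<Rightarrow> ('f, 'p, 'b) atom form \<Rightarrow> 'b form" where
  "T2B t2b = map_form t2b"

definition B2T :: "'b set \<Rightarrow> (('f, 'p, 'b) atom \<Rightarrow> 'b) \<Rightarrow> 'b form \<Rightarrow> ('f, 'p, 'b) atom form" where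
  "B2T B t2b = map_form (inv_into (T_atoms B) t2b)"

definition B_entails ::
  "(('f, 'p, 'b) atom \<Rightarrow> 'b) \<Rightarrow> ('f, 'p, 'b) atom form \<Rightarrow> ('f, 'p, 'b) atom form \<Rightarrow> bool" where
  "B_entails t2b \<phi> \<psi> \<longleftrightarrow> prop_entails (T2B t2b \<phi>) (T2B t2b \<psi>)"

definition B_equiv ::
  "(('f, 'p, 'b) atom \<Rightarrow> 'b) \<Rightarrow> ('f, 'p, 'b) atom form \<Rightarrow> ('f, 'p, 'b) atom form \<Rightarrow> bool" where
  "B_equiv t2b \<phi> \<psi> \<longleftrightarrow> prop_equiv (T2B t2b \<phi>) (T2B t2b \<psi>)"

definition total_assignments :: "'a set \<Rightarrow> 'a form set" where
  "total_assignments \<alpha> =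
     {BigAnd L | L. L \<subseteq> Atom ` \<alpha> \<union> (\<lambda>a. Not (Atom a)) ` \<alpha> \<and>
                    (\<forall>a\<in>\<alpha>. Atom a \<in> L \<longleftrightarrow> Not (Atom a) \<notin> L)}"

definition TTA ::
  "'u itself \<Rightarrow> ('f, 'p, 'b) fo_formula set \<Rightarrow> (('f, 'p, 'b) atom \<Rightarrow> 'b) \<Rightarrow> ('f, 'p, 'b) atom set
    \<Rightarrow> ('f, 'p, 'b) atom form \<Rightarrow> ('f, 'p, 'b) atom form set" where
  "TTA U T t2b \<alpha> \<phi> = {\<eta>\<in>total_assignments \<alpha>. T_consistent U T \<eta> \<and> B_entails t2b \<eta> \<phi>}"


section \<open>Decision diagrams\<close>

text \<open>A form of Boolean decision diagrams: for each set of Boolean variables the diagrams over it,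
  and the Boolean formula that a diagram stands for. Diagrams are kept apart from formulas because
  distinct diagrams (as graphs) may read as the same formula.\<close>

record ('d, 'b) dd_form =
  diagrams :: "'b set \<Rightarrow> 'd set"
  dd_formula :: "'d \<Rightarrow> 'b form"

definition wf_dd_form :: "('d, 'b) dd_form \<Rightarrow> bool" where
  "wf_dd_form F \<longleftrightarrow> (\<forall>A. \<forall>d\<in>diagrams F A. dd_formula F d \<in> formulas_over A)"

text \<open>A canonicity condition on the variables \<open>A\<close>, such as conformance to a fixed variable order or
  v-tree (and being reduced), is given by the diagrams that meet it; what makes it a canonicity
  condition is that a Boolean function over \<open>A\<close> has at most one such diagram.\<close>

definition canonicity_condition :: "('d, 'b) dd_form \<Rightarrow> 'b set \<Rightarrow> ('d \<Rightarrow> bool) \<Rightarrow> bool" where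
  "canonicity_condition F A K \<longleftrightarrow>
     (\<forall>d\<in>diagrams F A. \<forall>d'\<in>diagrams F A. K d \<longrightarrow> K d' \<longrightarrow>
        prop_equiv (dd_formula F d) (dd_formula F d') \<longrightarrow> d = d')"

text \<open>The theory formula whose Boolean abstraction is the diagram \<open>d\<close>.\<close>

definition TDD_formula ::
  "'b set \<Rightarrow> (('f, 'p, 'b) atom \<Rightarrow> 'b) \<Rightarrow> ('d, 'b) dd_form \<Rightarrow> 'd \<Rightarrow> ('f, 'p, 'b) atom form" where
  "TDD_formula B t2b F d = B2T B t2b (dd_formula F d)"

definition is_TDD ::
  "'u itself \<Rightarrow> ('f, 'p, 'b) fo_formula set \<Rightarrow> 'b set \<Rightarrow> (('f, 'p, 'b) atom \<Rightarrow> 'b)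
    \<Rightarrow> ('f, 'p, 'b) atom set \<Rightarrow> ('d, 'b) dd_form \<Rightarrow> ('d \<Rightarrow> bool) \<Rightarrow> ('f, 'p, 'b) atom form \<Rightarrow> 'd \<Rightarrow> bool"
where
  "is_TDD U T B t2b \<alpha> F K \<phi> d \<longleftrightarrow>
     d \<in> diagrams F (t2b ` \<alpha>) \<and> K d \<and> T_equiv U T (TDD_formula B t2b F d) \<phi>"

definition TDD_form ::
  "'u itself \<Rightarrow> ('f, 'p, 'b) fo_formula set \<Rightarrow> 'b set \<Rightarrow> (('f, 'p, 'b) atom \<Rightarrow> 'b)
    \<Rightarrow> ('f, 'p, 'b) atom set \<Rightarrow> ('d, 'b) dd_form \<Rightarrow> ('d \<Rightarrow> bool)
    \<Rightarrow> (('f, 'p, 'b) atom form \<Rightarrow> 'd) \<Rightarrow> bool" where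
  "TDD_form U T B t2b \<alpha> F K TDD \<longleftrightarrow>
     (\<forall>\<phi>\<in>formulas_over \<alpha>. is_TDD U T B t2b \<alpha> F K \<phi> (TDD \<phi>))"

definition B_canonical ::
  "(('f, 'p, 'b) atom \<Rightarrow> 'b) \<Rightarrow> ('f, 'p, 'b) atom set \<Rightarrow> (('f, 'p, 'b) atom form \<Rightarrow> 'd) \<Rightarrow> bool" where
  "B_canonical t2b \<alpha> TDD \<longleftrightarrow>
     (\<forall>\<phi>\<in>formulas_over \<alpha>. \<forall>\<phi>'\<in>formulas_over \<alpha>. B_equiv t2b \<phi> \<phi>' \<longrightarrow> TDD \<phi> = TDD \<phi>')"

definition T_canonical ::
  "'u itself \<Rightarrow> ('f, 'p, 'b) fo_formula set \<Rightarrow> ('f, 'p, 'b) atom set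
    \<Rightarrow> (('f, 'p, 'b) atom form \<Rightarrow> 'd) \<Rightarrow> bool" where
  "T_canonical U T \<alpha> TDD \<longleftrightarrow>
     (\<forall>\<phi>\<in>formulas_over \<alpha>. \<forall>\<phi>'\<in>formulas_over \<alpha>. TDD \<phi> = TDD \<phi>' \<longleftrightarrow> T_equiv U T \<phi> \<phi>')"

end

theory Submission
  imports Defs
begin

text \<open>A total assignment on \<open>\<alpha>\<close> fixes the truth value of every formula over \<open>\<alpha>\<close>. Hence, if it holds
  in a model \<open>M\<close>, it propositionally entails exactly those formulas over \<open>\<alpha>\<close> that hold in \<open>M\<close>, and so
  \<open>\<T>\<close>-equivalent formulas have the same \<open>\<T>\<close>-consistent total assignments. Their diagrams therefore
  stand for the same Boolean function, and the canonicity condition makes them equal.\<close>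

lemma eval_map_form: "eval v (map_form f \<phi>) \<longleftrightarrow> eval (v \<circ> f) \<phi>"
  by (induction \<phi>) auto

lemma eval_cong:
  assumes "\<And>a. a \<in> atoms \<phi> \<Longrightarrow> v a = w a"
  shows "eval v \<phi> \<longleftrightarrow> eval w \<phi>"
  using assms by (induction \<phi>) auto

lemma set_enum_of:
  assumes "finite S"
  shows "set (enum_of S) = S"
  using someI_ex[of "\<lambda>xs. distinct xs \<and> set xs = S"] finite_distinct_list[OF assms]
  unfolding enum_of_def by blast

lemma eval_BigAnd:
  assumes "finite S"
  shows "eval v (BigAnd S) \<longleftrightarrow> (\<forall>\<phi>\<in>S. eval v \<phi>)"
proof -
  have "eval v (foldr And xs Top) \<longleftrightarrow> (\<forall>\<phi>\<in>set xs. eval v \<phi>)" for xs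
    by (induction xs) auto
  then show ?thesis
    using set_enum_of[OF assms] by (simp add: BigAnd_def)
qed

text \<open>Exactly one literal of each atom of \<alpha> is a conjunct of \<eta>, so the valuations
  satisfying \<eta> are determined on \<alpha>, and one of them, \<open>v\<close>, describes all the
  others.\<close>

lemma eval_total_assignment_iff_agree:
  assumes "finite \<alpha>" and "\<eta> \<in> total_assignments \<alpha>" and "eval v \<eta>"
  shows "eval w \<eta> \<longleftrightarrow> (\<forall>a\<in>\<alpha>. w a = v a)"
proof -
  obtain L where \<eta>: "\<eta> = BigAnd L"
    and sub: "L \<subseteq> Atom ` \<alpha> \<union> (\<lambda>a. Not (Atom a)) ` \<alpha>"
    and total: "\<forall>a\<in>\<alpha>. Atom a \<in> L \<longleftrightarrow> Not (Atom a) \<notin> L"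
    using assms(2) unfolding total_assignments_def by blast
  \<comment> \<open>Only for a finite \<open>L\<close> is there a list for \<open>enum_of\<close> to
    choose, which makes \<open>BigAnd L\<close> the conjunction of \<open>L\<close>.\<close>
  have "finite L"
    using sub assms(1) by (meson finite_UnI finite_imageI finite_subset)
  then have iff: "eval u \<eta> \<longleftrightarrow> (\<forall>l\<in>L. eval u l)" for u
    unfolding \<eta> by (rule eval_BigAnd)
  have v: "\<forall>l\<in>L. eval v l"
    using assms(3) iff by blast
  show ?thesis
  proof
    assume "eval w \<eta>"
    then have w: "\<forall>l\<in>L. eval w l"
      using iff by blast
    show "\<forall>a\<in>\<alpha>. w a = v a"
    proof
      fix a assume "a \<in> \<alpha>"
      then have "Atom a \<in> L \<or> Not (Atom a) \<in> L"
        using total by blast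
      then show "w a = v a"
        using v w by fastforce
    qed
  next
    assume agree: "\<forall>a\<in>\<alpha>. w a = v a"
    have "eval w l" if "l \<in> L" for l
    proof -
      have "eval v l"
        using v that by blast
      moreover have "l \<in> Atom ` \<alpha> \<union> (\<lambda>a. Not (Atom a)) ` \<alpha>"
        using sub that by blast
      ultimately show ?thesis
        using agree by auto
    qed
    then show "eval w \<eta>"
      using iff by blast
  qed
qed

text \<open>A valuation of the Boolean variables satisfying the abstraction of \<eta> pulls back
  along \<open>t2b\<close> to a valuation of atoms that agrees with \<open>v\<close> on \<alpha>,
  hence gives \<phi> the same value as \<open>v\<close> does.\<close>

lemma total_assignment_B_entails_iff_eval:
  assumes "finite \<alpha>" and "inj_on t2b \<alpha>" and "\<phi> \<in> formulas_over \<alpha>"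
    and "\<eta> \<in> total_assignments \<alpha>" and "eval v \<eta>"
  shows "B_entails t2b \<eta> \<phi> \<longleftrightarrow> eval v \<phi>"
proof -
  have agree: "eval w \<eta> \<longleftrightarrow> (\<forall>a\<in>\<alpha>. w a = v a)" for w
    by (rule eval_total_assignment_iff_agree[OF assms(1,4,5)])
  have \<phi>: "eval w \<phi> \<longleftrightarrow> eval v \<phi>" if "\<forall>a\<in>\<alpha>. w a = v a" for w
    using assms(3) that by (intro eval_cong) (auto simp: formulas_over_def)
  \<comment> \<open>This valuation of the Boolean variables pulls back to \<open>v\<close> on
    \<alpha>, by injectivity of \<open>t2b\<close>. It satisfies the abstraction of \<eta>, so the
    entailment is not vacuous and does force \<phi> to hold under \<open>v\<close>.\<close>
  have "\<forall>a\<in>\<alpha>. ((v \<circ> inv_into \<alpha> t2b) \<circ> t2b) a = v a"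
    using assms(2) by simp
  then show ?thesis
    unfolding B_entails_def prop_entails_def T2B_def eval_map_form agree
    using \<phi> by blast
qed

text \<open>The preceding lemma applies to the valuation given by any model that witnesses the
  consistency of \<eta>. In this form \<phi> enters only through its truth in models of
  \<open>T\<close>, so the set is visibly invariant under \<open>T_equiv\<close>.\<close>

lemma TTA_eq_jointly_satisfied:
  assumes "finite \<alpha>" and "inj_on t2b \<alpha>" and "\<phi> \<in> formulas_over \<alpha>"
  shows "TTA U T t2b \<alpha> \<phi> =
    {\<eta>\<in>total_assignments \<alpha>. \<exists>M\<in>models U T. T_sat M \<eta> \<and> T_sat M \<phi>}"
  using total_assignment_B_entails_iff_eval[OF assms]
  unfolding TTA_def T_consistent_def T_sat_def by blast

text \<open>\<open>inv_into\<close> is a right inverse of \<open>t2b\<close> on the image of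
  \<open>T_atoms B\<close>, where all variables of \<psi> lie.\<close>

lemma T2B_B2T:
  assumes "\<psi> \<in> formulas_over (t2b ` T_atoms B)"
  shows "T2B t2b (B2T B t2b \<psi>) = \<psi>"
proof -
  have "map_form (t2b \<circ> inv_into (T_atoms B) t2b) \<psi> = map_form id \<psi>"
    using assms by (intro form.map_cong) (auto simp: formulas_over_def f_inv_into_f)
  then show ?thesis
    by (simp add: T2B_def B2T_def form.map_comp form.map_id)
qed

theorem theorem2:
  fixes U :: "'u itself"
    and T :: "('f, 'p, 'b) fo_formula set"
    and B :: "'b set"
    and t2b :: "('f, 'p, 'b) atom \<Rightarrow> 'b"
    and \<alpha> :: "('f, 'p, 'b) atom set"
    and F :: "('d, 'b) dd_form"
    and K :: "'d \<Rightarrow> bool"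
    and TDD :: "('f, 'p, 'b) atom form \<Rightarrow> 'd"
  assumes "fo_theory T"
    and "boolean_abstraction B t2b"
    and "\<alpha> \<subseteq> T_atoms B" and "finite \<alpha>"
    and "wf_dd_form F"
    and "canonicity_condition F (t2b ` \<alpha>) K"
    and "TDD_form U T B t2b \<alpha> F K TDD"
    and "B_canonical t2b \<alpha> TDD"
    and "\<And>\<phi>. \<phi> \<in> formulas_over \<alpha> \<Longrightarrow>
           B_equiv t2b (TDD_formula B t2b F (TDD \<phi>)) (BigOr (TTA U T t2b \<alpha> \<phi>))"
  shows "T_canonical U T \<alpha> TDD"
proof -
  have inj: "inj_on t2b \<alpha>"
    using assms(2,3) inj_on_subset unfolding boolean_abstraction_def by blast
  have tdd: "TDD \<phi> \<in> diagrams F (t2b ` \<alpha>)" "K (TDD \<phi>)"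
    "T_equiv U T (TDD_formula B t2b F (TDD \<phi>)) \<phi>" if "\<phi> \<in> formulas_over \<alpha>" for \<phi>
    using assms(7) that by (auto simp: TDD_form_def is_TDD_def)
  \<comment> \<open>\<open>B_equiv\<close> compares abstractions of theory formulas, the canonicity
    condition compares formulas of diagrams; this identity links the two.\<close>
  have abstr: "T2B t2b (TDD_formula B t2b F (TDD \<phi>)) = dd_formula F (TDD \<phi>)"
    if "\<phi> \<in> formulas_over \<alpha>" for \<phi>
  proof -
    have "dd_formula F (TDD \<phi>) \<in> formulas_over (t2b ` \<alpha>)"
      using assms(5) tdd(1)[OF that] by (auto simp: wf_dd_form_def)
    then have "dd_formula F (TDD \<phi>) \<in> formulas_over (t2b ` T_atoms B)"
      using assms(3) unfolding formulas_over_def by blast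
    then show ?thesis
      unfolding TDD_formula_def by (rule T2B_B2T)
  qed
  have "TDD \<phi> = TDD \<phi>' \<longleftrightarrow> T_equiv U T \<phi> \<phi>'"
    if \<phi>: "\<phi> \<in> formulas_over \<alpha>" and \<phi>': "\<phi>' \<in> formulas_over \<alpha>" for \<phi> \<phi>'
  proof
    assume "TDD \<phi> = TDD \<phi>'"
    \<comment> \<open>Both formulas are equivalent modulo \<open>T\<close> to the formula of their
      common diagram.\<close>
    then show "T_equiv U T \<phi> \<phi>'"
      using tdd(3)[OF \<phi>] tdd(3)[OF \<phi>'] by (simp add: T_equiv_def)
  next
    assume "T_equiv U T \<phi> \<phi>'"
    then have "TTA U T t2b \<alpha> \<phi> = TTA U T t2b \<alpha> \<phi>'"
      unfolding TTA_eq_jointly_satisfied[OF assms(4) inj \<phi>]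
        TTA_eq_jointly_satisfied[OF assms(4) inj \<phi>'] T_equiv_def by blast
    \<comment> \<open>Equal sets yield the very same formula \<open>BigOr\<close>, whose abstraction
      is propositionally equivalent to the formulas of both diagrams.\<close>
    then have "prop_equiv (dd_formula F (TDD \<phi>)) (dd_formula F (TDD \<phi>'))"
      using assms(9)[OF \<phi>] assms(9)[OF \<phi>']
      by (simp add: B_equiv_def prop_equiv_def abstr \<phi> \<phi>')
    then show "TDD \<phi> = TDD \<phi>'"
      using assms(6) tdd(1,2)[OF \<phi>] tdd(1,2)[OF \<phi>']
      unfolding canonicity_condition_def by blast
  qed
  then show ?thesis
    unfolding T_canonical_def by blast
qed

end
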